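(* As $n\to\infty$, $f_{n-2}(n)\le \left(N_{n-2,n}^{(2)}\right)^{1+o(1)}$. That is, for every $\varepsilon>0$ there is $n_0$ such that $f_{n-2}(n)\le \left(N_{n-2,n}^{(2)}\right)^{1+\varepsilon}$ for all integers $n\ge n_0$.
   Context: For $1\le j\le n$, $\sigma_j(x_1,\dots,x_n)=\sum_{1\le i_1<\dots<i_j\le n}x_{i_1}\cdots x_{i_j}$. For $n\ge 3$ let $\mathcal{S}_n$ be the set of $n$-tuples of integers $(x_1,\dots,x_n)$ with $1\le x_1\le\dots\le x_n$ and $\sigma_{n-2}(x_1,\dots,x_n)=\sigma_n(x_1,\dots,x_n)$; this set is finite and nonempty. Put $f_{n-2}(n)=|\mathcal{S}_n|$ and $N_{n-2,n}^{(2)}=\max\{x_1x_2\cdots x_{n-2}:(x_1,\dots,x_n)\in\mathcal{S}_n\}$ (the product of the $n-2$ smallest entries). *)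

theory Defs
  imports "HOL-Analysis.Analysis"
begin

definition esym :: "nat \<Rightarrow> int list \<Rightarrow> int" where
  "esym j xs = (\<Sum>I | I \<subseteq> {..<length xs} \<and> card I = j. \<Prod>i\<in>I. xs ! i)"

definition Sol :: "nat \<Rightarrow> int list set" where
  "Sol n = {xs. length xs = n \<and> sorted xs \<and> (\<forall>x\<in>set xs. 1 \<le> x) \<and>
                esym (n - 2) xs = esym n xs}"

definition num_sol :: "nat \<Rightarrow> nat" where
  "num_sol n = card (Sol n)"

definition max_prod :: "nat \<Rightarrow> int" where
  "max_prod n = Max ((\<lambda>xs. prod_list (take (n - 2) xs)) ` Sol n)"

text \<open>The cardinality and the maximum above are only meaningful because the
  solution set is finite and, for \<open>n \<ge> 3\<close>, nonempty.\<close>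

lemma esym_length: "esym (length xs) xs = prod_list xs"
proof -
  have "{I. I \<subseteq> {..<length xs} \<and> card I = length xs} = {{..<length xs}}"
    by (auto dest: card_subset_eq[OF finite_lessThan])
  then show ?thesis
    by (simp add: esym_def prod.list_conv_set_nth atLeast0LessThan)
qed

lemma esym_snoc: "esym (Suc j) (xs @ [y]) = esym (Suc j) xs + y * esym j xs"
proof -
  let ?n = "length xs"
  let ?A = "{I. I \<subseteq> {..<?n} \<and> card I = Suc j}"
  let ?B = "{I. I \<subseteq> {..<?n} \<and> card I = j}"
  have fin: "finite I" if "I \<subseteq> {..<?n}" for I
    using that finite_subset by blast
  have split: "{I. I \<subseteq> {..<length (xs @ [y])} \<and> card I = Suc j} = ?A \<union> insert ?n ` ?B"
    (is "?L = ?R")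
  proof
    show "?L \<subseteq> ?R"
    proof
      fix I assume I: "I \<in> ?L"
      then have fI: "finite I" using finite_subset by blast
      show "I \<in> ?R"
      proof (cases "?n \<in> I")
        case True
        have "I = insert ?n (I - {?n})" using True by auto
        moreover have "I - {?n} \<in> ?B" using I True fI
          by (auto simp: less_Suc_eq)
        ultimately show ?thesis by blast
      next
        case False
        then show ?thesis using I by (auto simp: less_Suc_eq)
      qed
    qed
    show "?R \<subseteq> ?L"
      by (auto simp: card_insert_if fin less_Suc_eq)
  qed
  have inj: "inj_on (insert ?n) ?B"
    by (rule inj_onI) (metis (no_types, lifting) insert_ident lessThan_iff less_irrefl mem_Collect_eq subsetD)
  have disj: "?A \<inter> insert ?n ` ?B = {}" by auto
  have "esym (Suc j) (xs @ [y]) =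
      (\<Sum>I\<in>?A. \<Prod>i\<in>I. (xs @ [y]) ! i) + (\<Sum>I\<in>insert ?n ` ?B. \<Prod>i\<in>I. (xs @ [y]) ! i)"
    unfolding esym_def split by (rule sum.union_disjoint) (use disj in auto)
  also have "(\<Sum>I\<in>?A. \<Prod>i\<in>I. (xs @ [y]) ! i) = esym (Suc j) xs"
    unfolding esym_def by (intro sum.cong refl prod.cong) (auto simp: nth_append)
  also have "(\<Sum>I\<in>insert ?n ` ?B. \<Prod>i\<in>I. (xs @ [y]) ! i) = (\<Sum>I\<in>?B. y * (\<Prod>i\<in>I. xs ! i))"
  proof (subst sum.reindex[OF inj], rule sum.cong[OF refl])
    fix I assume "I \<in> ?B"
    then have *: "finite I" "?n \<notin> I" "I \<subseteq> {..<?n}" using fin by auto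
    have "(\<Prod>i\<in>I. (xs @ [y]) ! i) = (\<Prod>i\<in>I. xs ! i)"
      using * by (intro prod.cong) (auto simp: nth_append)
    then show "((\<lambda>I. \<Prod>i\<in>I. (xs @ [y]) ! i) \<circ> insert ?n) I = y * (\<Prod>i\<in>I. xs ! i)"
      using * by simp
  qed
  finally show ?thesis by (simp add: esym_def sum_distrib_left)
qed

lemma Sol_nonempty:
  assumes "n \<ge> 3"
  shows "Sol n \<noteq> {}"
proof -
  have ex: "\<exists>xs. length xs = m + 2 \<and> sorted xs \<and> (\<forall>x\<in>set xs. 1 \<le> x \<and> x \<le> esym (m + 1) xs) \<and>
      esym (m + 2) xs - esym m xs = 1 \<and> 1 \<le> esym (m + 2) xs" for m
  proof (induction m)
    case 0
    have e0: "esym 0 ys = 1" for ys :: "int list"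
    proof -
      have "{I. I \<subseteq> {..<length ys} \<and> card I = 0} = {{}}"
        using finite_subset[OF _ finite_lessThan] by auto
      then show ?thesis by (simp add: esym_def)
    qed
    have e1: "esym (Suc j) [] = 0" for j
      by (simp add: esym_def)
    have "esym 1 [1] = 1"
      using esym_snoc[of 0 "[]" 1] by (simp add: e0 e1)
    then have s1: "esym 1 [1, 2] = 3"
      using esym_snoc[of 0 "[1]" 2] by (simp add: e0)
    have s2: "esym 2 [1, 2] = 2"
      using esym_length[of "[1, 2]"] by (simp add: numeral_2_eq_2)
    show ?case
      by (intro exI[of _ "[1, 2]"]) (simp add: e0 s1 s2 flip: One_nat_def)
  next
    case (Suc m)
    then obtain xs where xs: "length xs = m + 2" "sorted xs"
      "\<And>x. x \<in> set xs \<Longrightarrow> 1 \<le> x \<and> x \<le> esym (m + 1) xs"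
      "esym (m + 2) xs - esym m xs = 1" "1 \<le> esym (m + 2) xs" by blast
    define A where "A = esym (m + 1) xs"
    let ?ys = "xs @ [A + 1]"
    have big: "esym (m + 3) xs = 0"
    proof -
      have "card I \<noteq> m + 3" if "I \<subseteq> {..<length xs}" for I
        using card_mono[OF finite_lessThan that] xs(1) by simp
      then have "{I. I \<subseteq> {..<length xs} \<and> card I = m + 3} = {}" by blast
      then show ?thesis by (simp only: esym_def sum.empty)
    qed
    have Apos: "1 \<le> A" using xs(3)[of "xs ! 0"] nth_mem[of 0 xs] xs(1) unfolding A_def by linarith
    have s1: "esym (m + 1) ?ys = A + (A + 1) * esym m xs"
      using esym_snoc[of m xs "A + 1"] by (simp add: A_def)
    have s2: "esym (m + 2) ?ys = esym (m + 2) xs + (A + 1) * A"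
      using esym_snoc[of "m + 1" xs "A + 1"] by (simp add: A_def)
    have s3: "esym (m + 3) ?ys = (A + 1) * esym (m + 2) xs"
      using esym_snoc[of "m + 2" xs "A + 1"] big by (simp add: numeral_3_eq_3)
    have s31: "esym (m + 3) ?ys - esym (m + 1) ?ys = 1"
    proof -
      have "esym (m + 3) ?ys - esym (m + 1) ?ys = (A + 1) * (esym (m + 2) xs - esym m xs) - A"
        unfolding s1 s3 by (simp add: algebra_simps)
      then show ?thesis using xs(4) by simp
    qed
    have s3pos: "1 \<le> esym (m + 3) ?ys"
      unfolding s3 using Apos xs(5) mult_mono[of 1 "A + 1" 1 "esym (m + 2) xs"] by simp
    have ge: "A + 1 \<le> esym (m + 2) ?ys"
    proof -
      have "(A + 1) * 1 \<le> (A + 1) * A" using Apos by (intro mult_left_mono) auto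
      then have "A + 1 \<le> (A + 1) * A" by (simp only: mult_1_right)
      also have "\<dots> \<le> esym (m + 2) ?ys" unfolding s2 using xs(5) by simp
      finally show ?thesis .
    qed
    have bnd: "1 \<le> x \<and> x \<le> esym (m + 2) ?ys" if "x \<in> set ?ys" for x
      using that xs(3)[of x] Apos ge by (auto simp: A_def)
    have "x \<le> A + 1" if "x \<in> set xs" for x
      using xs(3)[OF that] by (simp add: A_def)
    then have srt: "sorted ?ys" using xs(2) by (simp add: sorted_append)
    have "length ?ys = m + 3 \<and> sorted ?ys \<and> (\<forall>x\<in>set ?ys. 1 \<le> x \<and> x \<le> esym (m + 2) ?ys) \<and>
        esym (m + 3) ?ys - esym (m + 1) ?ys = 1 \<and> 1 \<le> esym (m + 3) ?ys"
      using xs(1) srt bnd s31 s3pos by simp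
    moreover have "Suc m + 2 = m + 3" "Suc m + 1 = m + 2" "Suc m = m + 1" by simp_all
    ultimately show ?case by metis
  qed
  obtain m where n: "n = m + 3" using assms using le_Suc_ex[of 3 n] by (auto simp: add.commute)
  obtain xs where xs: "length xs = m + 2" "sorted xs"
    "\<And>x. x \<in> set xs \<Longrightarrow> 1 \<le> x \<and> x \<le> esym (m + 1) xs" "esym (m + 2) xs - esym m xs = 1"
    using ex[of m] by blast
  define A where "A = esym (m + 1) xs"
  let ?ys = "xs @ [A]"
  have Apos: "1 \<le> A" using xs(3)[of "xs ! 0"] nth_mem[of 0 xs] xs(1) unfolding A_def by linarith
  have "esym (m + 1) ?ys = A + A * esym m xs"
    using esym_snoc[of m xs A] by (simp add: A_def)
  also have "\<dots> = A * esym (m + 2) xs"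
  proof -
    have "esym (m + 2) xs = 1 + esym m xs" using xs(4) by simp
    then show ?thesis by (simp add: algebra_simps)
  qed
  also have "\<dots> = esym (m + 3) ?ys"
    using esym_length[of ?ys] esym_length[of xs] xs(1) by (simp add: numeral_3_eq_3)
  finally have "esym (n - 2) ?ys = esym n ?ys" by (simp add: n)
  moreover have "x \<le> A" "1 \<le> x" if "x \<in> set xs" for x
    using xs(3)[OF that] by (simp_all add: A_def)
  ultimately have "?ys \<in> Sol n"
    using xs(1,2) Apos n by (simp add: Sol_def sorted_append)
  then show ?thesis by blast
qed

lemma Sol_reciprocals:
  assumes "xs \<in> Sol n" "n \<ge> 2"
  shows "(\<Sum>J | J \<subseteq> {..<n} \<and> card J = 2. 1 / real_of_int (\<Prod>i\<in>J. xs ! i)) = 1"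
proof -
  have len: "length xs = n" and pos: "\<And>i. i < n \<Longrightarrow> 1 \<le> xs ! i"
    and eq: "esym (n - 2) xs = esym n xs"
    using assms by (auto simp: Sol_def)
  let ?P = "real_of_int (prod_list xs)"
  have P: "prod_list xs = (\<Prod>i<n. xs ! i)"
    using len by (simp add: prod.list_conv_set_nth atLeast0LessThan)
  have Ppos: "?P > 0" unfolding P of_int_0_less_iff by (rule prod_pos) (use pos in force)
  have "?P = real_of_int (esym (n - 2) xs)" using eq esym_length[of xs] len by simp
  also have "\<dots> = (\<Sum>I | I \<subseteq> {..<n} \<and> card I = n - 2. real_of_int (\<Prod>i\<in>I. xs ! i))"
    by (simp add: esym_def len)
  also have "\<dots> = (\<Sum>J | J \<subseteq> {..<n} \<and> card J = 2. ?P / real_of_int (\<Prod>i\<in>J. xs ! i))"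
  proof (rule sum.reindex_bij_witness[where i = "\<lambda>J. {..<n} - J" and j = "\<lambda>J. {..<n} - J"])
    fix I assume I: "I \<in> {I. I \<subseteq> {..<n} \<and> card I = n - 2}"
    then have fI: "finite I" using finite_subset by blast
    show "{..<n} - ({..<n} - I) = I" using I by auto
    show "{..<n} - I \<in> {J. J \<subseteq> {..<n} \<and> card J = 2}"
      using I fI assms(2) by (auto simp: card_Diff_subset)
    have "prod_list xs = (\<Prod>i\<in>{..<n} - I. xs ! i) * (\<Prod>i\<in>I. xs ! i)"
      unfolding P using I by (intro prod.subset_diff) auto
    moreover have "(\<Prod>i\<in>{..<n} - I. xs ! i) > 0" by (rule prod_pos) (use pos in force)
    ultimately show "?P / real_of_int (\<Prod>i\<in>{..<n} - I. xs ! i) = real_of_int (\<Prod>i\<in>I. xs ! i)"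
      by (metis nonzero_mult_div_cancel_left of_int_eq_0_iff of_int_mult order_less_irrefl)
  next
    fix J assume J: "J \<in> {J. J \<subseteq> {..<n} \<and> card J = 2}"
    then have fJ: "finite J" using finite_subset by blast
    show "{..<n} - ({..<n} - J) = J" using J by auto
    show "{..<n} - J \<in> {I. I \<subseteq> {..<n} \<and> card I = n - 2}"
      using J fJ by (auto simp: card_Diff_subset)
  qed
  also have "\<dots> = ?P * (\<Sum>J | J \<subseteq> {..<n} \<and> card J = 2. 1 / real_of_int (\<Prod>i\<in>J. xs ! i))"
    by (simp add: sum_distrib_left)
  finally show ?thesis using Ppos by simp
qed

lemma finite_Sol:
  assumes "n \<ge> 2"
  shows "finite (Sol n)"
proof -
  define E where "E k ys = (\<Sum>J | J \<subseteq> {..<k} \<and> card J = 2. 1 / real_of_int (\<Prod>i\<in>J. ys ! i))"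
    for k :: nat and ys :: "int list"
  have bound: "real_of_int (xs ! k) \<le> 2 ^ n / (1 - E k (take k xs))"
    if xs: "xs \<in> Sol n" and k: "k < n" for xs k
  proof -
    have len: "length xs = n" and srt: "sorted xs" and pos: "\<And>i. i < n \<Longrightarrow> 1 \<le> xs ! i"
      using xs by (auto simp: Sol_def)
    let ?r = "\<lambda>J. 1 / real_of_int (\<Prod>i\<in>J. xs ! i)"
    let ?T = "{J. J \<subseteq> {..<n} \<and> card J = 2}" and ?U = "{J. J \<subseteq> {..<k} \<and> card J = 2}"
    have rpos: "?r J > 0" if "J \<subseteq> {..<n}" for J
    proof -
      have "(\<Prod>i\<in>J. xs ! i) > 0" by (rule prod_pos) (use pos that in force)
      then show ?thesis by (simp only: zero_less_divide_1_iff of_int_0_less_iff)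
    qed
    have "finite ?T" by simp
    moreover have "?U \<subseteq> ?T" using k by auto
    ultimately have "sum ?r ?T = sum ?r (?T - ?U) + sum ?r ?U" by (metis (no_types, lifting) sum.subset_diff)
    moreover have "sum ?r ?T = 1" using Sol_reciprocals[OF xs assms] .
    moreover have "sum ?r ?U = E k (take k xs)"
      unfolding E_def by (intro sum.cong refl arg_cong[where f = "\<lambda>z. 1 / real_of_int z"] prod.cong) auto
    ultimately have rest: "sum ?r (?T - ?U) = 1 - E k (take k xs)" by simp
    have kpos: "xs ! k \<ge> 1" using pos k by simp
    have le: "?r J \<le> 1 / real_of_int (xs ! k)" if J: "J \<in> ?T - ?U" for J
    proof -
      have fJ: "finite J" using J finite_subset by blast
      obtain i where i: "i \<in> J" "k \<le> i" "i < n" using J by (auto simp: subset_eq not_less)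
      have "xs ! k \<le> xs ! i" using srt i len by (simp add: sorted_nth_mono)
      also have "xs ! i \<le> xs ! i * (\<Prod>j\<in>J - {i}. xs ! j)"
      proof -
        have "1 \<le> (\<Prod>j\<in>J - {i}. xs ! j)" by (rule prod_ge_1) (use J pos in auto)
        then show ?thesis using pos[OF i(3)] by simp
      qed
      also have "\<dots> = (\<Prod>j\<in>J. xs ! j)" using fJ i by (simp add: prod.remove)
      finally have "real_of_int (xs ! k) \<le> real_of_int (\<Prod>j\<in>J. xs ! j)" by (simp only: of_int_le_iff)
      then show ?thesis using kpos by (intro divide_left_mono) auto
    qed
    have "card (?T - ?U) \<le> card (Pow {..<n})" by (rule card_mono) auto
    then have "real (card (?T - ?U)) \<le> 2 ^ n" by (simp add: card_Pow)
    then have ub: "sum ?r (?T - ?U) \<le> 2 ^ n * (1 / real_of_int (xs ! k))"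
      using sum_bounded_above[of "?T - ?U" ?r "1 / real_of_int (xs ! k)"] le kpos
        mult_right_mono[of "real (card (?T - ?U))" "2 ^ n" "1 / real_of_int (xs ! k)"]
      by fastforce
    obtain l where l: "l < n" "l \<noteq> k"
    proof (cases "k = 0")
      case True then show ?thesis using that[of 1] assms by simp
    next
      case False then show ?thesis using that[of 0] assms by simp
    qed
    have kl: "{k, l} \<in> ?T - ?U" using l k by auto
    have "sum ?r (?T - ?U) > 0"
    proof (rule sum_pos2[OF _ kl])
      show "0 < ?r {k, l}" using rpos[of "{k, l}"] kl by blast
      show "0 \<le> ?r J" if "J \<in> ?T - ?U" for J
        using rpos[of J] that by (intro less_imp_le) blast
    qed auto
    then show ?thesis using ub kpos unfolding rest by (simp add: field_simps)
  qed
  have "finite (take k ` Sol n)" if "k \<le> n" for k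
    using that
  proof (induction k)
    case 0
    have "take 0 ` Sol n \<subseteq> {[]}" by auto
    then show ?case using finite_subset by blast
  next
    case (Suc k)
    have "take (Suc k) ` Sol n \<subseteq>
        (\<Union>ys\<in>take k ` Sol n. (\<lambda>z. ys @ [z]) ` {1..\<lfloor>2 ^ n / (1 - E k ys)\<rfloor>})"
    proof
      fix zs assume "zs \<in> take (Suc k) ` Sol n"
      then obtain xs where xs: "xs \<in> Sol n" "zs = take (Suc k) xs" by blast
      then have "zs = take k xs @ [xs ! k]" "1 \<le> xs ! k"
        using Suc.prems by (auto simp: Sol_def take_Suc_conv_app_nth)
      moreover have "xs ! k \<le> \<lfloor>2 ^ n / (1 - E k (take k xs))\<rfloor>"
        using bound[OF xs(1)] Suc.prems by (simp add: le_floor_iff)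
      ultimately show "zs \<in> (\<Union>ys\<in>take k ` Sol n. (\<lambda>z. ys @ [z]) ` {1..\<lfloor>2 ^ n / (1 - E k ys)\<rfloor>})"
        using xs(1) by (intro UN_I[of "take k xs"]) auto
    qed
    moreover have "finite (take k ` Sol n)" using Suc by simp
    ultimately show ?case by (rule finite_subset[OF _ finite_UN_I]) simp
  qed
  from this[of n] have "finite (take n ` Sol n)" by simp
  moreover have "take n ` Sol n = Sol n" by (auto simp: Sol_def image_iff)
  ultimately show ?thesis by simp
qed

end

theory Submission
  imports Defs "HOL-Computational_Algebra.Primes"
begin

text \<open>
  Fix the \<open>n - 2\<close> smallest entries and let \<open>P\<close>, \<open>Q\<close>, \<open>R\<close> be their elementary symmetric polynomials
  of degree \<open>n - 2\<close>, \<open>n - 3\<close>, \<open>n - 4\<close>. With \<open>D = P - R\<close>, the two largest entries \<open>x\<close>, \<open>y\<close> satisfy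
  \<open>(D x - Q) (D y - Q) = Q\<^sup>2 + P D\<close>, so there are at most as many of them as divisors of a number
  which is at most \<open>n\<^sup>2 P\<^sup>2\<close>, hence \<open>(n P)\<close> to the power \<open>o(1)\<close>.
  The number of choices for the small entries is at most the number of unordered factorisations
  of the integers up to \<open>N\<close>, the maximal value of \<open>P\<close>. Rankin's trick bounds it for every \<open>s > 1\<close>
  by \<open>N\<^sup>s\<close> times the product over \<open>j \<ge> 2\<close> of the geometric series in \<open>1 / j\<^sup>s\<close>, which converges.
  Finally, all entries except possibly two are at least \<open>2\<close>, because the reciprocals of the
  pairwise products sum to \<open>1\<close>; so \<open>N \<ge> 2\<^bsup>n - 4\<^esup>\<close>, and powers of \<open>n\<close> and constants are harmless.
\<close>

section \<open>The divisor bound\<close>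

lemma card_divisors_prime_power_mult:
  fixes p y :: nat
  assumes "prime p" "y > 0"
  shows "card {d. d dvd p ^ a * y} \<le> (a + 1) * card {d. d dvd y}"
proof -
  have fin: "finite {d. d dvd y}" using assms(2) by simp
  have "{d. d dvd p ^ a * y} \<subseteq> (\<lambda>(i, d). p ^ i * d) ` ({..a} \<times> {d. d dvd y})"
  proof
    fix d assume "d \<in> {d. d dvd p ^ a * y}"
    then obtain b c where "d = b * c" "b dvd p ^ a" "c dvd y"
      using division_decomp by blast
    then show "d \<in> (\<lambda>(i, d). p ^ i * d) ` ({..a} \<times> {d. d dvd y})"
      using divides_primepow_nat[OF assms(1)] by auto
  qed
  then have "card {d. d dvd p ^ a * y} \<le> card ({..a} \<times> {d. d dvd y})"
    using fin by (intro surj_card_le) auto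
  then show ?thesis by (simp add: card_cartesian_product)
qed

text \<open>Induction on \<open>S\<close> splits off one prime power at a time. \<open>S\<close> may
  contain primes that do not divide \<open>m\<close>; they do no harm, since the hypothesis at
  \<open>a = 0\<close> gives \<open>1 \<le> c p\<close>.\<close>

lemma card_divisors_le_prod:
  fixes \<delta> :: real and c :: "nat \<Rightarrow> real"
  assumes c: "\<And>p a. prime p \<Longrightarrow> real (a + 1) \<le> c p * real (p ^ a) powr \<delta>"
  assumes "finite S" "m > 0" "prime_factors m \<subseteq> S" "\<forall>p\<in>S. prime p"
  shows "real (card {d. d dvd m}) \<le> (\<Prod>p\<in>S. c p) * real m powr \<delta>"
  using assms(2-)
proof (induction S arbitrary: m rule: finite_induct)
  case empty
  then have "m = 1" using prime_factor_nat[of m] prime_factorsI[of m] by blast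
  then show ?case by simp
next
  case (insert p S)
  have p: "prime p" using insert.prems by simp
  obtain y where y: "m = p ^ multiplicity p m * y" "\<not> p dvd y"
    using multiplicity_decompose'[of m p] insert.prems prime_gt_1_nat[OF p] by auto
  define a where "a = multiplicity p m"
  have m: "m = p ^ a * y" using y a_def by simp
  have y0: "y > 0" using insert.prems m by (intro gr0I) auto
  have "prime_factors y \<subseteq> S"
  proof
    fix q assume q: "q \<in> prime_factors y"
    then have "q \<in> prime_factors m" using m insert.prems by (auto simp: in_prime_factors_iff)
    moreover have "q \<noteq> p" using q y(2) by auto
    ultimately show "q \<in> S" using insert.prems by auto
  qed
  then have IH: "real (card {d. d dvd y}) \<le> (\<Prod>p\<in>S. c p) * real y powr \<delta>"
    using insert.IH[of y] insert.prems y0 by simp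
  have "real (card {d. d dvd m}) \<le> real ((a + 1) * card {d. d dvd y})"
    unfolding m using card_divisors_prime_power_mult[OF p y0] by (rule of_nat_mono)
  also have "\<dots> = real (a + 1) * real (card {d. d dvd y})" by (simp only: of_nat_mult)
  also have "\<dots> \<le> (c p * real (p ^ a) powr \<delta>) * ((\<Prod>p\<in>S. c p) * real y powr \<delta>)"
    using order_trans[OF _ c[OF p, of a], of 0] by (intro mult_mono c[OF p] IH) auto
  also have "\<dots> = (\<Prod>p\<in>insert p S. c p) * real m powr \<delta>"
    using insert.hyps unfolding m by (simp add: powr_mult)
  finally show ?case .
qed

text \<open>The local factor is (a + 1) / p^(a \<delta>). It is at most 1 once p^\<delta> \<ge> 2,
  because a + 1 \<le> 2^a, and it is bounded uniformly in a at each of the finitely many smaller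
  primes.\<close>

lemma divisor_bound:
  fixes \<delta> :: real
  assumes "\<delta> > 0"
  shows "\<exists>C\<ge>1. \<forall>m::nat. m > 0 \<longrightarrow> real (card {d. d dvd m}) \<le> C * real m powr \<delta>"
proof -
  \<comment> \<open>Chosen so that \<open>K * \<delta> * ln 2 \<ge> 1\<close>, which gives a + 1
    \<le> K (1 + a \<delta> ln 2) \<le> K 2^(a \<delta>); the maximum with 1 takes care of the
    summand 1.\<close>
  define K where "K = max 1 (1 / (\<delta> * ln 2))"
  define B where "B = nat \<lceil>2 powr (1 / \<delta>)\<rceil>"
  \<comment> \<open>Only the primes with \<open>p powr \<delta> < 2\<close> can contribute a factor greater than \<open>1\<close>\<close>
  define c where "c p = (if p < B then K else 1)" for p :: nat
  have K1: "K \<ge> 1" by (simp add: K_def)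
  have c: "real (a + 1) \<le> c p * real (p ^ a) powr \<delta>" if p: "prime p" for p a
  proof -
    have p2: "real p \<ge> 2" using prime_ge_2_nat[OF p] by simp
    show ?thesis
    proof (cases "p < B")
      case True
      have "K * (\<delta> * ln 2) \<ge> 1"
        using assms mult_right_mono[of "1 / (\<delta> * ln 2)" K "\<delta> * ln 2"] by (simp add: K_def)
      then have "real a * 1 \<le> real a * (K * (\<delta> * ln 2))" by (intro mult_left_mono) auto
      then have "real (a + 1) \<le> K * (1 + real a * \<delta> * ln 2)" using K1 by (simp add: algebra_simps)
      also have "\<dots> \<le> K * exp (real a * \<delta> * ln 2)" using K1 by (intro mult_left_mono exp_ge_add_one_self) auto
      also have "\<dots> = K * (2 ^ a) powr \<delta>" by (simp add: powr_def ln_realpow mult_ac)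
      also have "\<dots> \<le> K * real (p ^ a) powr \<delta>"
        using K1 p2 assms by (intro mult_left_mono powr_mono2) (auto intro: power_mono)
      finally show ?thesis using True by (simp add: c_def)
    next
      case False
      then have "2 powr (1 / \<delta>) \<le> real p" by (simp add: B_def) linarith
      then have "(2 powr (1 / \<delta>)) powr \<delta> \<le> real p powr \<delta>" using assms by (intro powr_mono2) auto
      then have "2 \<le> real p powr \<delta>" using assms by (simp add: powr_powr)
      then have "2 ^ a \<le> (real p powr \<delta>) ^ a" by (intro power_mono) auto
      also have "\<dots> = real (p ^ a) powr \<delta>" using p2 by (simp add: powr_power powr_realpow[symmetric] powr_powr mult.commute)
      finally have "2 ^ a \<le> real (p ^ a) powr \<delta>" .
      moreover have "real (a + 1) \<le> 2 ^ a"
      proof -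
        have "a + 1 \<le> 2 ^ a" by (induction a) auto
        then have "real (a + 1) \<le> real (2 ^ a)" by (rule of_nat_mono)
        then show ?thesis by simp
      qed
      ultimately show ?thesis using False by (simp add: c_def)
    qed
  qed
  have "real (card {d. d dvd m}) \<le> K ^ B * real m powr \<delta>" if "m > 0" for m :: nat
  proof -
    have "real (card {d. d dvd m}) \<le> (\<Prod>p\<in>prime_factors m. c p) * real m powr \<delta>"
      by (rule card_divisors_le_prod[OF c]) (use that in auto)
    also have "(\<Prod>p\<in>prime_factors m. c p) = (\<Prod>p\<in>prime_factors m \<inter> {..<B}. K)"
      unfolding c_def by (simp add: prod.If_cases lessThan_def)
    also have "\<dots> = K ^ card (prime_factors m \<inter> {..<B})" by simp
    \<comment> \<open>At most \<open>B\<close> small primes divide \<open>m\<close>, so the constant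
      does not depend on \<open>m\<close>.\<close>
    also have "\<dots> \<le> K ^ B"
      using card_mono[of "{..<B}" "prime_factors m \<inter> {..<B}"] K1 by (intro power_increasing) auto
    finally show ?thesis by (simp add: mult_right_mono)
  qed
  then show ?thesis using K1 by (intro exI[of _ "K ^ B"]) simp
qed

section \<open>Counting the pairs of largest entries\<close>

text \<open>A point yields the divisor \<open>D * x - Q\<close> of \<open>M\<close>; since the
  cofactor is \<open>D * y - Q\<close> and \<open>D > 0\<close>, the divisor determines the point.
  The size bound comes from \<open>D \<le> P\<close>.\<close>

lemma card_rectangular_hyperbola:
  fixes P Q R :: int
  assumes "P \<ge> 1" "Q \<ge> 0" "R \<ge> 0"
  obtains m :: nat where "m > 0" "int m \<le> Q\<^sup>2 + P\<^sup>2"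
    "finite {(x, y). x \<ge> 1 \<and> y \<ge> 1 \<and> P + Q * (x + y) + R * x * y = P * x * y}"
    "card {(x, y). x \<ge> 1 \<and> y \<ge> 1 \<and> P + Q * (x + y) + R * x * y = P * x * y} \<le> card {d. d dvd m}"
proof -
  define A where "A = {(x, y). x \<ge> 1 \<and> y \<ge> 1 \<and> P + Q * (x + y) + R * x * y = P * x * y}"
  define D where "D = P - R"
  define M where "M = Q\<^sup>2 + P * D"
  show ?thesis
  proof (cases "A = {}")
    \<comment> \<open>Without a point \<open>M\<close> need not be positive, so \<open>m = 1\<close>
      is taken instead.\<close>
    case True
    have "1 \<le> P\<^sup>2" using assms by simp
    then have "int 1 \<le> Q\<^sup>2 + P\<^sup>2" using zero_le_power2[of Q] by linarith
    moreover have "finite A" "card A \<le> card {d. d dvd (1::nat)}" using True by simp_all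
    ultimately show ?thesis using that[of 1] unfolding A_def by simp
  next
    case False
    have fact: "D * x - Q > 0 \<and> (D * x - Q) * (D * y - Q) = M" if "(x, y) \<in> A" for x y
    proof -
      have xy: "x \<ge> 1" "y \<ge> 1" "P + Q * (x + y) + R * x * y = P * x * y" using that by (auto simp: A_def)
      \<comment> \<open>The sign of the factor is read off from the equation solved for
        \<open>y\<close>, before the sign of \<open>D\<close> is known.\<close>
      have "(D * x - Q) * y = P + Q * x" using xy(3) by (simp add: D_def algebra_simps)
      moreover have "P + Q * x > 0" using assms xy by (simp add: add_pos_nonneg)
      ultimately have "(D * x - Q) * y > 0" by simp
      then have "D * x - Q > 0" using xy by (simp add: zero_less_mult_iff)
      moreover have "(D * x - Q) * (D * y - Q) = M"
      proof -
        have "(D * x - Q) * (D * y - Q) = D * (P * x * y - R * x * y - Q * (x + y)) + Q\<^sup>2"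
          by (simp add: D_def algebra_simps power2_eq_square)
        also have "P * x * y - R * x * y - Q * (x + y) = P" using xy(3) by simp
        finally show ?thesis by (simp add: M_def algebra_simps)
      qed
      ultimately show ?thesis by simp
    qed
    have fact': "D * y - Q > 0" if "(x, y) \<in> A" for x y
      using fact[of y x] that by (simp add: A_def algebra_simps)
    obtain x0 y0 where x0: "(x0, y0) \<in> A" using False by auto
    then have Dx: "D * x0 > 0" using fact[OF x0] assms by linarith
    then have D: "D > 0" using x0 by (simp add: A_def zero_less_mult_iff)
    have M: "M > 0" unfolding M_def using D assms by (simp add: add_nonneg_pos)
    have inj: "inj_on (\<lambda>(x, y). nat (D * x - Q)) A"
    proof (rule inj_onI, clarify)
      fix x y x' y'
      assume xy: "(x, y) \<in> A" "(x', y') \<in> A" and eq: "nat (D * x - Q) = nat (D * x' - Q)"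
      have *: "D * x - Q = D * x' - Q"
        using eq fact[OF xy(1)] fact[OF xy(2)] by linarith
      then have "D * y - Q = D * y' - Q"
        using fact[OF xy(1)] fact[OF xy(2)] by (metis less_irrefl mult_left_cancel)
      with * show "x = x' \<and> y = y'" using D by simp
    qed
    have sub: "(\<lambda>(x, y). nat (D * x - Q)) ` A \<subseteq> {d. d dvd nat M}"
    proof clarsimp
      fix x y assume xy: "(x, y) \<in> A"
      then have "nat M = nat (D * x - Q) * nat (D * y - Q)"
        using fact[OF xy] fact'[OF xy] by (simp flip: nat_mult_distrib)
      then show "nat (D * x - Q) dvd nat M" by simp
    qed
    have fin: "finite {d. d dvd nat M}" using M by simp
    have "card A \<le> card {d. d dvd nat M}" "finite A"
      using card_inj_on_le[OF inj sub fin] inj_on_finite[OF inj sub fin] .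
    moreover have "int (nat M) \<le> Q\<^sup>2 + P\<^sup>2"
      using M assms mult_left_mono[of D P P] by (simp add: M_def D_def power2_eq_square)
    ultimately show ?thesis using that[of "nat M"] M by (simp add: A_def)
  qed
qed

section \<open>Counting factorisations by Rankin's trick\<close>

lemma prod_list_ge_1:
  fixes zs :: "int list"
  assumes "\<forall>x\<in>set zs. 1 \<le> x"
  shows "1 \<le> prod_list zs"
  using assms
proof (induction zs)
  case (Cons z zs)
  then show ?case using mult_mono[of 1 z 1 "prod_list zs"] by simp
qed simp

lemma le_prod_list:
  fixes zs :: "int list"
  assumes "\<forall>x\<in>set zs. 1 \<le> x" "x \<in> set zs"
  shows "x \<le> prod_list zs"
  using assms
proof (induction zs)
  case (Cons z zs)
  have 1: "1 \<le> prod_list zs" using Cons.prems by (intro prod_list_ge_1) auto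
  show ?case
  proof (cases "x = z")
    case True
    then show ?thesis using 1 Cons.prems by simp
  next
    case False
    then have "x \<le> prod_list zs" using Cons by auto
    also have "\<dots> \<le> z * prod_list zs" using 1 Cons.prems mult_right_mono[of 1 z "prod_list zs"] by simp
    finally show ?thesis by simp
  qed
qed simp

lemma prod_list_eq_prod_power_count:
  fixes zs :: "'a::comm_monoid_mult list"
  assumes "set zs \<subseteq> X" "finite X"
  shows "prod_list zs = (\<Prod>x\<in>X. x ^ count_list zs x)"
  using assms
proof (induction zs)
  case (Cons z zs)
  have "(\<Prod>x\<in>X. x ^ count_list (z # zs) x) = (\<Prod>x\<in>X. (if x = z then x else 1) * x ^ count_list zs x)"
    by (intro prod.cong) auto
  also have "\<dots> = z * (\<Prod>x\<in>X. x ^ count_list zs x)"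
    using Cons.prems by (simp add: prod.distrib prod.delta)
  finally show ?case using Cons by simp
qed simp

lemma sorted_eqI_count:
  fixes xs ys :: "'a::linorder list"
  assumes "sorted xs" "sorted ys" "\<And>x. count_list xs x = count_list ys x"
  shows "xs = ys"
proof -
  have "mset xs = mset ys" using assms(3) by (intro multiset_eqI) (simp add: count_mset)
  then have "sort xs = ys" using assms(2) by (intro properties_for_sort) simp_all
  then show ?thesis using sorted_sort_id[OF assms(1)] by simp
qed

text \<open>These are the multiplicative partitions of the integers up to \<open>N\<close> into at
  most \<open>k\<close> parts above 1, padded with ones to length \<open>k\<close>.\<close>

definition sorted_factor_lists :: "nat \<Rightarrow> int \<Rightarrow> int list set" where
  "sorted_factor_lists k N = {zs. length zs = k \<and> sorted zs \<and> (\<forall>x\<in>set zs. 1 \<le> x) \<and> prod_list zs \<le> N}"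

text \<open>The constant is uniform in \<open>k\<close>, which is essential because
  \<open>k = n - 2\<close> grows in the application. Lists are encoded by their multiplicities, and
  the weighted sum over all exponent vectors is a finite Euler-type product.\<close>

lemma card_sorted_factor_lists_le:
  fixes s :: real
  assumes s: "s > 1"
  shows "\<exists>C\<ge>1. \<forall>k. \<forall>N\<ge>1. finite (sorted_factor_lists k N) \<and>
    real (card (sorted_factor_lists k N)) \<le> C * real_of_int N powr s"
proof -
  \<comment> \<open>This is zeta(s): the term at 0 vanishes because
    \<open>0 powr a = 0\<close>.\<close>
  define Z where "Z = (\<Sum>n. real n powr (-s))"
  have summ: "summable (\<lambda>n. real n powr (-s))" using s by (simp add: summable_real_powr_iff)
  have Z0: "Z \<ge> 0" unfolding Z_def by (intro suminf_nonneg summ) simp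
  have main: "finite T \<and> real (card T) \<le> exp (2 * Z) * real_of_int N powr s"
    if N: "N \<ge> 1" and T: "T = sorted_factor_lists k N"
    for T k and N :: int
  proof -
    note T_def = T[unfolded sorted_factor_lists_def]
    \<comment> \<open>The entry 1 is left out, since its geometric sum would contribute a factor
      \<open>k + 1\<close>.\<close>
    define A where "A = {2..N}"
    define F where "F = A \<rightarrow>\<^sub>E {..k}"
    define r where "r j = real_of_int j powr (-s)" for j
    define w where "w c = (\<Prod>j\<in>A. real_of_int j ^ c j)" for c :: "int \<Rightarrow> nat"
    define G where "G = {c\<in>F. w c \<le> N}"
    have finF: "finite F" unfolding F_def A_def by (intro finite_PiE) auto
    then have finG: "finite G" by (simp add: G_def)
    have ins: "insert 1 A = {1..N}" "1 \<notin> A" "finite A" using N by (auto simp: A_def)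
    have set: "set zs \<subseteq> {1..N}" if "zs \<in> T" for zs
      using that le_prod_list[of zs] by (fastforce simp: T_def)
    have inj: "inj_on (\<lambda>zs. restrict (count_list zs) A) T"
    proof (rule inj_onI)
      fix xs ys assume xy: "xs \<in> T" "ys \<in> T" and eq: "restrict (count_list xs) A = restrict (count_list ys) A"
      have A: "count_list xs x = count_list ys x" if "x \<in> A" for x
        using fun_cong[OF eq, of x] that by simp
      \<comment> \<open>Both lists have length \<open>k\<close>, so the multiplicity of 1 follows
        from the others.\<close>
      have "sum (count_list xs) (insert 1 A) = sum (count_list ys) (insert 1 A)"
        using sum_count_set[of xs "{1..N}"] sum_count_set[of ys "{1..N}"] xy set
        unfolding ins by (simp add: T_def)
      then have "count_list xs 1 = count_list ys 1" using A ins(2,3) by simp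
      then have "count_list xs x = count_list ys x" if "x \<in> {1..N}" for x
        using A that unfolding ins(1)[symmetric] by auto
      moreover have "count_list xs x = count_list ys x" if "x \<notin> {1..N}" for x
        using that set xy by (metis count_notin subsetD)
      ultimately have "count_list xs x = count_list ys x" for x by blast
      then show "xs = ys" using xy by (intro sorted_eqI_count) (auto simp: T_def)
    qed
    have sub: "(\<lambda>zs. restrict (count_list zs) A) ` T \<subseteq> G"
    proof clarify
      fix zs assume z: "zs \<in> T"
      have "prod_list zs = (\<Prod>x\<in>insert 1 A. x ^ count_list zs x)"
        using set[OF z] unfolding ins by (intro prod_list_eq_prod_power_count) auto
      also have "\<dots> = (\<Prod>x\<in>A. x ^ count_list zs x)" using ins(2,3) by simp
      finally have "w (restrict (count_list zs) A) = real_of_int (prod_list zs)"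
        unfolding w_def by simp
      then show "restrict (count_list zs) A \<in> G"
        using z count_le_length[of zs] by (auto simp: G_def F_def T_def)
    qed
    have rpos: "r j > 0" "r j \<le> 1 / 2" if "j \<in> A" for j
    proof -
      have j: "j \<ge> 2" using that by (simp add: A_def)
      show "r j > 0" using j by (simp add: r_def)
      have "r j \<le> 2 powr (-s)" unfolding r_def using j s by (intro powr_mono2') auto
      also have "\<dots> \<le> 2 powr (-1)" using s by (intro powr_mono) auto
      finally show "r j \<le> 1 / 2" by (simp add: powr_minus)
    qed
    \<comment> \<open>Rankin's trick: \<open>1 \<le> (N / w c)\<^sup>s\<close> whenever \<open>w c \<le> N\<close>\<close>
    have wt: "1 \<le> real_of_int N powr s * (\<Prod>j\<in>A. r j ^ c j)" if "c \<in> G" for c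
    proof -
      have w0: "w c > 0" unfolding w_def by (rule prod_pos) (auto simp: A_def)
      have "(\<Prod>j\<in>A. r j ^ c j) = w c powr (-s)"
      proof -
        have "w c powr (-s) = (\<Prod>j\<in>A. (real_of_int j ^ c j) powr (-s))"
          unfolding w_def by (rule prod_powr_distrib)
        also have "\<dots> = (\<Prod>j\<in>A. r j ^ c j)"
          unfolding r_def by (intro prod.cong) (auto simp: A_def powr_power powr_realpow[symmetric] powr_powr mult.commute)
        finally show ?thesis by simp
      qed
      then have "real_of_int N powr s * (\<Prod>j\<in>A. r j ^ c j) = (real_of_int N / w c) powr s"
        using w0 N by (simp add: powr_divide powr_minus_divide)
      moreover have "1 \<le> real_of_int N / w c" using that w0 by (simp add: G_def)
      ultimately show ?thesis using s by (simp add: ge_one_powr_ge_zero)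
    qed
    \<comment> \<open>For 0 < r \<le> 1/2 one has (1 - r)(1 + 2r) = 1 + r(1 - 2r) \<ge> 1, so the
      geometric sum is at most 1 + 2r.\<close>
    have geo: "(\<Sum>i\<le>k. r j ^ i) \<le> exp (2 * r j)" if "j \<in> A" for j
    proof -
      let ?r = "r j"
      have "(1 - ?r) * (\<Sum>i\<le>k. ?r ^ i) = 1 - ?r ^ Suc k" by (rule sum_gp_basic)
      also have "\<dots> \<le> 1" using rpos[OF that] by simp
      also have "1 \<le> (1 - ?r) * (1 + 2 * ?r)"
        using rpos[OF that] mult_left_mono[of "?r" "1/2" "?r"] by (simp add: algebra_simps)
      finally have "(\<Sum>i\<le>k. ?r ^ i) \<le> 1 + 2 * ?r" using rpos[OF that] by simp
      also have "\<dots> \<le> exp (2 * ?r)" by (rule exp_ge_add_one_self)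
      finally show ?thesis .
    qed
    have sumr: "(\<Sum>j\<in>A. r j) \<le> Z"
    proof -
      have "(\<Sum>j\<in>A. r j) = (\<Sum>n\<in>{2..nat N}. real n powr (-s))"
        by (rule sum.reindex_bij_witness[where i = int and j = nat]) (auto simp: A_def r_def)
      also have "\<dots> \<le> Z" unfolding Z_def by (intro sum_le_suminf summ) auto
      finally show ?thesis .
    qed
    have "real (card T) \<le> real (card G)" using card_inj_on_le[OF inj sub finG] by simp
    also have "\<dots> = (\<Sum>c\<in>G. 1)" by simp
    also have "\<dots> \<le> (\<Sum>c\<in>G. real_of_int N powr s * (\<Prod>j\<in>A. r j ^ c j))"
      by (intro sum_mono wt)
    \<comment> \<open>Dropping the constraint \<open>w c \<le> N\<close> makes the exponents
      independent, so the sum factors over \<open>A\<close>.\<close>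
    also have "\<dots> \<le> (\<Sum>c\<in>F. real_of_int N powr s * (\<Prod>j\<in>A. r j ^ c j))"
      by (intro sum_mono2 finF mult_nonneg_nonneg prod_nonneg) (auto simp: G_def r_def)
    also have "\<dots> = real_of_int N powr s * (\<Prod>j\<in>A. \<Sum>i\<le>k. r j ^ i)"
      using prod_sum_PiE[of A "\<lambda>_. {..k}" "\<lambda>j i. r j ^ i"] ins(3)
      by (simp add: F_def sum_distrib_left)
    also have "\<dots> \<le> real_of_int N powr s * (\<Prod>j\<in>A. exp (2 * r j))"
      by (intro mult_left_mono prod_mono) (auto intro!: geo sum_nonneg zero_le_power less_imp_le[OF rpos(1)])
    also have "(\<Prod>j\<in>A. exp (2 * r j)) = exp (2 * (\<Sum>j\<in>A. r j))"
      using ins(3) by (simp add: exp_sum sum_distrib_left)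
    also have "real_of_int N powr s * exp (2 * (\<Sum>j\<in>A. r j)) \<le> real_of_int N powr s * exp (2 * Z)"
      using sumr by (intro mult_left_mono) auto
    finally show ?thesis using inj_on_finite[OF inj sub finG] by (simp add: mult.commute)
  qed
  show ?thesis
    by (rule exI[of _ "exp (2 * Z)"]) (use Z0 main in simp)
qed

section \<open>Sizes of the symmetric polynomials and of the entries\<close>

lemma esym_nonneg:
  assumes "\<forall>x\<in>set zs. 1 \<le> x"
  shows "0 \<le> esym j zs"
  unfolding esym_def
proof (intro sum_nonneg prod_nonneg)
  fix I i assume "I \<in> {I. I \<subseteq> {..<length zs} \<and> card I = j}" "i \<in> I"
  then have "zs ! i \<in> set zs" by auto
  then show "0 \<le> zs ! i" using assms by fastforce
qed

text \<open>Each partial product is completed to the full one by factors that are at least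
  1.\<close>

lemma esym_le_binomial_mult_prod_list:
  assumes "\<forall>x\<in>set zs. 1 \<le> x"
  shows "esym j zs \<le> int (length zs choose j) * prod_list zs"
proof -
  have ge1: "1 \<le> zs ! i" if "i < length zs" for i using assms that by simp
  have "esym j zs \<le> int (card {I. I \<subseteq> {..<length zs} \<and> card I = j}) * prod_list zs"
    unfolding esym_def
  proof (rule sum_bounded_above)
    fix I assume "I \<in> {I. I \<subseteq> {..<length zs} \<and> card I = j}"
    then have I: "I \<subseteq> {..<length zs}" by simp
    have "(\<Prod>i\<in>I. zs ! i) * 1 \<le> (\<Prod>i\<in>I. zs ! i) * (\<Prod>i\<in>{..<length zs} - I. zs ! i)"
      using I ge1 by (intro mult_left_mono prod_ge_1 prod_nonneg) (auto, force)
    also have "\<dots> = prod_list zs"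
      using prod.subset_diff[OF I, of "(!) zs"]
      by (simp add: prod.list_conv_set_nth atLeast0LessThan mult.commute)
    finally show "(\<Prod>i\<in>I. zs ! i) \<le> prod_list zs" by simp
  qed
  then show ?thesis by (simp add: n_subsets)
qed

text \<open>Indices start at 0. Otherwise the three smallest entries would be 1, and the pairs {0,1}
  and {0,2} alone would contribute 2 to a sum of reciprocals equal to 1.\<close>

lemma Sol_nth_ge_2:
  assumes "xs \<in> Sol n" "2 \<le> i" "i < n"
  shows "2 \<le> xs ! i"
proof (rule ccontr)
  assume "\<not> 2 \<le> xs ! i"
  have len: "length xs = n" and srt: "sorted xs" and pos: "\<And>i. i < n \<Longrightarrow> 1 \<le> xs ! i"
    using assms(1) by (auto simp: Sol_def)
  have one: "xs ! j = 1" if "j \<le> i" for j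
    using sorted_nth_mono[OF srt that] pos[of j] \<open>\<not> 2 \<le> xs ! i\<close> assms len that by simp
  let ?r = "\<lambda>J. 1 / real_of_int (\<Prod>i\<in>J. xs ! i)"
  have ne: "{0, 1::nat} \<noteq> {0, 2}" by (simp add: doubleton_eq_iff)
  have "2 = sum ?r {{0, 1}, {0, 2}}"
    using one[of 0] one[of 1] one[of 2] assms(2) ne by simp
  also have "\<dots> \<le> sum ?r {J. J \<subseteq> {..<n} \<and> card J = 2}"
  proof (rule sum_mono2)
    show "0 \<le> ?r J" if "J \<in> {J. J \<subseteq> {..<n} \<and> card J = 2} - {{0, 1}, {0, 2}}" for J
    proof -
      have "J \<subseteq> {..<n}" using that by blast
      then have "(\<Prod>i\<in>J. xs ! i) \<ge> 0" by (intro prod_nonneg) (use pos in force)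
      then show ?thesis by (simp only: of_int_0_le_iff zero_le_divide_1_iff)
    qed
  qed (use assms in auto)
  also have "\<dots> = 1" using Sol_reciprocals[OF assms(1)] assms by simp
  finally show False by simp
qed

lemma power_2_le_prod_list_take_Sol:
  assumes "xs \<in> Sol n" "n \<ge> 4"
  shows "2 ^ (n - 4) \<le> prod_list (take (n - 2) xs)"
proof -
  have len: "length xs = n" and pos: "\<And>i. i < n \<Longrightarrow> 1 \<le> xs ! i"
    using assms(1) by (auto simp: Sol_def)
  have "(2::int) ^ (n - 4) = (\<Prod>i<n - 2. if i < 2 then 1 else 2)"
  proof -
    have "{..<n - 2} \<inter> - {i. i < 2} = {2..<n - 2}" by auto
    moreover have "n - 2 - 2 = n - 4" by simp
    ultimately show ?thesis by (simp add: prod.If_cases)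
  qed
  also have "\<dots> \<le> (\<Prod>i<n - 2. xs ! i)"
    using pos Sol_nth_ge_2[OF assms(1)] by (intro prod_mono) auto
  also have "\<dots> = prod_list (take (n - 2) xs)"
    using len by (simp add: prod.list_conv_set_nth atLeast0LessThan)
  finally show ?thesis .
qed

section \<open>Solutions with prescribed small entries\<close>

lemma card_Sol_fibre:
  assumes "n \<ge> 4" "zs \<in> take (n - 2) ` Sol n"
  obtains m :: nat where "m > 0" "int m \<le> int n ^ 2 * prod_list zs ^ 2"
    "card {xs \<in> Sol n. take (n - 2) xs = zs} \<le> card {d. d dvd m}"
proof -
  \<comment> \<open>With n = k + 4 the degrees n - 2, n - 3, n - 4 become successors of
    \<open>k\<close>, which avoids truncated subtraction and lets \<open>esym_snoc\<close> expand
    both last entries.\<close>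
  obtain k where k: "n = Suc (Suc (Suc (Suc k)))"
    using le_Suc_ex[OF assms(1)] by auto
  define F where "F = {xs \<in> Sol n. take (n - 2) xs = zs}"
  define P Q R where "P = prod_list zs" and "Q = esym (Suc k) zs" and "R = esym k zs"
  have len: "length zs = Suc (Suc k)" and pos: "\<forall>x\<in>set zs. 1 \<le> x"
    using assms(2) k by (auto simp: Sol_def dest: in_set_takeD)
  have P: "P \<ge> 1" and Q: "Q \<ge> 0" and R: "R \<ge> 0"
    using pos by (simp_all add: P_def Q_def R_def prod_list_ge_1 esym_nonneg)
  \<comment> \<open>The binomial coefficient is (k + 2 choose k + 1) = k + 2.\<close>
  have QP: "Q \<le> (int k + 2) * P"
    using esym_le_binomial_mult_prod_list[OF pos, of "Suc k"] len by (simp add: Q_def P_def add.commute)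
  let ?H = "{(x, y). x \<ge> 1 \<and> y \<ge> 1 \<and> P + Q * (x + y) + R * x * y = P * x * y}"
  obtain m where m: "m > 0" "int m \<le> Q\<^sup>2 + P\<^sup>2" "finite ?H" "card ?H \<le> card {d. d dvd m}"
    using card_rectangular_hyperbola[OF P Q R] .
  define g where "g xs = (xs ! (n - 2), xs ! (n - 1))" for xs :: "int list"
  have decomp: "xs = zs @ [fst (g xs), snd (g xs)]" if "xs \<in> F" for xs
  proof -
    have xs: "length xs = n" "take (n - 2) xs = zs" using that by (auto simp: F_def Sol_def)
    have "xs = take (n - 2) xs @ drop (n - 2) xs" by simp
    also have "drop (n - 2) xs = [xs ! (n - 2), xs ! (n - 1)]"
      using xs(1) k by (simp flip: Cons_nth_drop_Suc)
    finally show ?thesis using xs by (simp add: g_def)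
  qed
  have inj: "inj_on g F" by (rule inj_onI) (metis decomp)
  have sub: "g ` F \<subseteq> ?H"
  proof (rule image_subsetI)
    fix xs assume xs: "xs \<in> F"
    obtain x y where g: "g xs = (x, y)" by fastforce
    have eq: "xs = (zs @ [x]) @ [y]" using decomp[OF xs] g by simp
    have sol: "esym (n - 2) xs = esym n xs" "\<forall>x\<in>set xs. 1 \<le> x" using xs by (auto simp: F_def Sol_def)
    have "esym (n - 2) xs = P + Q * (x + y) + R * x * y"
      unfolding eq k using esym_length[of zs] len
      by (simp add: esym_snoc P_def Q_def R_def algebra_simps del: append_assoc)
    moreover have "esym n xs = P * x * y"
      using esym_length[of xs] len unfolding eq k by (simp add: P_def)
    moreover have "1 \<le> x" "1 \<le> y" using sol(2) unfolding eq by auto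
    ultimately show "g xs \<in> ?H" using sol(1) by (simp add: g)
  qed
  have "card F \<le> card {d. d dvd m}"
    using card_inj_on_le[OF inj sub m(3)] m(4) by simp
  moreover have "int m \<le> int n ^ 2 * prod_list zs ^ 2"
  proof -
    have "Q\<^sup>2 \<le> (int k + 2)\<^sup>2 * P\<^sup>2"
      unfolding power_mult_distrib[symmetric] using QP Q by (intro power_mono)
    then have "int m \<le> ((int k + 2)\<^sup>2 + 1) * P\<^sup>2" using m(2) by (simp add: distrib_right)
    \<comment> \<open>Here (k + 2)^2 + 1 \<le> (k + 4)^2 = n^2.\<close>
    also have "\<dots> \<le> (int n)\<^sup>2 * P\<^sup>2"
      by (intro mult_right_mono) (auto simp: k power2_eq_square algebra_simps)
    finally show ?thesis by (simp add: P_def)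
  qed
  ultimately show ?thesis using that m(1) by (simp add: F_def)
qed

section \<open>Combining the two counts\<close>

theorem lemma13:
  shows "\<forall>\<epsilon>::real. \<epsilon> > 0 \<longrightarrow>
    (\<exists>n0::nat. \<forall>n\<ge>n0. real (num_sol n) \<le> real_of_int (max_prod n) powr (1 + \<epsilon>))"
proof (intro allI impI)
  fix \<epsilon> :: real assume \<epsilon>: "\<epsilon> > 0"
  \<comment> \<open>Balanced so that s + 3 \<delta> = 1 + \<epsilon>/2; the other \<epsilon>/2
    absorbs the constant \<open>C0\<close>.\<close>
  define s \<delta> where "s = 1 + \<epsilon> / 4" and "\<delta> = \<epsilon> / 12"
  have "s > 1" "\<delta> > 0" using \<epsilon> by (simp_all add: s_def \<delta>_def)
  obtain C where C: "C \<ge> 1"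
    and T: "\<And>k N. N \<ge> 1 \<Longrightarrow> finite (sorted_factor_lists k N)"
      "\<And>k N. N \<ge> 1 \<Longrightarrow> real (card (sorted_factor_lists k N)) \<le> C * real_of_int N powr s"
    using card_sorted_factor_lists_le[OF \<open>s > 1\<close>] by blast
  obtain C' where C': "C' \<ge> 1"
    and div: "\<And>m::nat. m > 0 \<Longrightarrow> real (card {d. d dvd m}) \<le> C' * real m powr \<delta>"
    using divisor_bound[OF \<open>\<delta> > 0\<close>] by blast
  define C0 where "C0 = C * C' * 16 powr \<delta>"
  have C0: "C0 \<ge> 0" using C C' by (simp add: C0_def)
  \<comment> \<open>For such n, N \<ge> 2^(n - 4) > n - 4 \<ge> C0^(2/\<epsilon>), hence C0 \<le>
    N^(\<epsilon>/2).\<close>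
  define n0 where "n0 = 4 + nat \<lceil>C0 powr (2 / \<epsilon>)\<rceil>"
  have "real (num_sol n) \<le> real_of_int (max_prod n) powr (1 + \<epsilon>)" if n: "n \<ge> n0" for n
  proof -
    have n4: "n \<ge> 4" using n by (simp add: n0_def)
    define N where "N = max_prod n"
    define B where "B = take (n - 2) ` Sol n"
    have fin: "finite (Sol n)" using n4 by (intro finite_Sol) simp
    then have finB: "finite B" by (simp add: B_def)
    have le_N: "prod_list (take (n - 2) xs) \<le> N" if "xs \<in> Sol n" for xs
      unfolding N_def max_prod_def using fin that by (intro Max_ge) auto
    obtain xs0 where xs0: "xs0 \<in> Sol n" using Sol_nonempty[of n] n4 by auto
    have N2: "2 ^ (n - 4) \<le> N"
      using power_2_le_prod_list_take_Sol[OF xs0 n4] le_N[OF xs0] by simp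
    have N1: "N \<ge> 1" using N2 one_le_power[of "2::int" "n - 4"] by linarith
    \<comment> \<open>From n^2 \<le> 2^n = 16 * 2^(n - 4) for n \<ge> 4; this is the source of the
      constant 16.\<close>
    have n2: "int n ^ 2 \<le> 16 * N"
    proof -
      have "n ^ 2 \<le> 2 ^ n" using n4
      proof (induction n rule: dec_induct)
        case (step m)
        have "Suc m ^ 2 \<le> 2 * m ^ 2"
        proof -
          have "4 * m \<le> m * m" using step.hyps by (intro mult_le_mono1)
          then have "Suc (2 * m) \<le> m * m" using step.hyps by linarith
          then show ?thesis by (simp add: power2_eq_square)
        qed
        then show ?case using step.IH by simp
      qed simp
      then have "int n ^ 2 \<le> 2 ^ n" by (metis of_nat_le_iff of_nat_numeral of_nat_power)
      also have "(2::int) ^ n = 16 * 2 ^ (n - 4)"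
        using n4 power_add[of "2::int" 4 "n - 4"] by simp
      finally show ?thesis using N2 by simp
    qed
    \<comment> \<open>Of the cube, one factor \<open>N\<close> pays for n^2 and two for the squared
      product of the small entries.\<close>
    have fibre: "real (card {xs \<in> Sol n. take (n - 2) xs = zs}) \<le> C' * (16 * real_of_int N ^ 3) powr \<delta>"
      if zs: "zs \<in> B" for zs
    proof -
      obtain m where m: "m > 0" "int m \<le> int n ^ 2 * prod_list zs ^ 2"
        "card {xs \<in> Sol n. take (n - 2) xs = zs} \<le> card {d. d dvd m}"
        using card_Sol_fibre[OF n4 zs[unfolded B_def]] .
      have "1 \<le> prod_list zs" "prod_list zs \<le> N"
        using zs le_N by (auto simp: B_def Sol_def dest: in_set_takeD intro!: prod_list_ge_1)
      then have "prod_list zs ^ 2 \<le> N ^ 2" by (intro power_mono) auto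
      then have "int m \<le> (16 * N) * N ^ 2"
        using m(2) n2 N1 by (intro order_trans[OF m(2)] mult_mono) auto
      then have "int m \<le> 16 * N ^ 3" by (simp add: power2_eq_square power3_eq_cube)
      then have "real_of_int (int m) \<le> real_of_int (16 * N ^ 3)" by (simp only: of_int_le_iff)
      then have "real m \<le> 16 * real_of_int N ^ 3" by simp
      then have "real m powr \<delta> \<le> (16 * real_of_int N ^ 3) powr \<delta>"
        using \<open>\<delta> > 0\<close> by (intro powr_mono2) auto
      then have "C' * real m powr \<delta> \<le> C' * (16 * real_of_int N ^ 3) powr \<delta>"
        using C' by (intro mult_left_mono) auto
      then show ?thesis using div[OF m(1)] m(3) by linarith
    qed
    have cardB: "real (card B) \<le> C * real_of_int N powr s"
    proof -
      have "B \<subseteq> sorted_factor_lists (n - 2) N"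
        using le_N by (auto simp: B_def Sol_def sorted_factor_lists_def dest: in_set_takeD)
      then have "card B \<le> card (sorted_factor_lists (n - 2) N)"
        by (intro card_mono T(1)[OF N1])
      then show ?thesis using T(2)[OF N1, of "n - 2"] by linarith
    qed
    \<comment> \<open>The solutions are partitioned by their n - 2 smallest entries;
      \<open>cardB\<close> counts the classes and \<open>fibre\<close> bounds each of them.\<close>
    have "num_sol n = card (\<Union>zs\<in>B. {xs \<in> Sol n. take (n - 2) xs = zs})"
      unfolding num_sol_def by (rule arg_cong[where f = card]) (auto simp: B_def)
    also have "\<dots> \<le> (\<Sum>zs\<in>B. card {xs \<in> Sol n. take (n - 2) xs = zs})"
      by (rule card_UN_le[OF finB])
    finally have "real (num_sol n) \<le> real (\<Sum>zs\<in>B. card {xs \<in> Sol n. take (n - 2) xs = zs})"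
      by (rule of_nat_mono)
    also have "\<dots> \<le> (\<Sum>zs\<in>B. C' * (16 * real_of_int N ^ 3) powr \<delta>)"
      unfolding of_nat_sum by (intro sum_mono fibre)
    also have "\<dots> = real (card B) * (C' * (16 * real_of_int N ^ 3) powr \<delta>)" by simp
    also have "\<dots> \<le> (C * real_of_int N powr s) * (C' * (16 * real_of_int N ^ 3) powr \<delta>)"
      using C' by (intro mult_right_mono cardB) auto
    also have "(16 * real_of_int N ^ 3) powr \<delta> = 16 powr \<delta> * real_of_int N powr (3 * \<delta>)"
    proof -
      have "real_of_int N ^ 3 = real_of_int N powr 3" using N1 powr_realpow[of "real_of_int N" 3] by simp
      then have "(real_of_int N ^ 3) powr \<delta> = real_of_int N powr (3 * \<delta>)"
        by (simp only: powr_powr)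
      then show ?thesis by (simp add: powr_mult)
    qed
    also have "(C * real_of_int N powr s) * (C' * (16 powr \<delta> * real_of_int N powr (3 * \<delta>)))
        = C0 * real_of_int N powr (1 + \<epsilon> / 2)"
    proof -
      have "real_of_int N powr s * real_of_int N powr (3 * \<delta>) = real_of_int N powr (1 + \<epsilon> / 2)"
        by (simp add: s_def \<delta>_def add.commute flip: powr_add)
      then show ?thesis by (simp add: C0_def mult_ac)
    qed
    also have "\<dots> \<le> real_of_int N powr (\<epsilon> / 2) * real_of_int N powr (1 + \<epsilon> / 2)"
    proof (intro mult_right_mono)
      have "C0 powr (2 / \<epsilon>) \<le> real (n - 4)" using n unfolding n0_def by linarith
      also have "\<dots> \<le> 2 ^ (n - 4)" using less_exp[of "n - 4"] by (metis less_imp_le of_nat_le_iff of_nat_numeral of_nat_power)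
      also have "\<dots> \<le> real_of_int N" using N2 by (metis of_int_le_iff of_int_numeral of_int_power)
      finally have "(C0 powr (2 / \<epsilon>)) powr (\<epsilon> / 2) \<le> real_of_int N powr (\<epsilon> / 2)"
        using \<epsilon> by (intro powr_mono2) auto
      then show "C0 \<le> real_of_int N powr (\<epsilon> / 2)" using \<epsilon> C0 by (simp add: powr_powr)
    qed auto
    also have "\<dots> = real_of_int N powr (1 + \<epsilon>)" by (simp add: add.commute flip: powr_add)
    finally show ?thesis by (simp add: N_def)
  qed
  then show "\<exists>n0::nat. \<forall>n\<ge>n0. real (num_sol n) \<le> real_of_int (max_prod n) powr (1 + \<epsilon>)" by blast
qed

end
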